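(* Let $i, n$ be positive integers with $i\leq n$ and $n\geq 2$, let $t_{1},\ldots,t_{n-2}$ be independent variables, and let $\mathbb{Q}(t_{1},\ldots,t_{n-2})$ be the field of rational functions in these variables (equal to $\mathbb{Q}$ if $n=2$). Then the set of those $a\in\mathbb{Q}(t_{1},\ldots,t_{n-2})\setminus\{0\}$ for which the system of equations $$\sigma_{i}(x_{1},\ldots,x_{2n})=a,\quad \sigma_{2n-i}(x_{1},\ldots,x_{2n})=a,\quad \sigma_{2n}(x_{1},\ldots,x_{2n})=1$$ has infinitely many solutions $(x_{1},\ldots,x_{2n})$ with all $x_{j}\in\mathbb{Q}(t_{1},\ldots,t_{n-2})$ is infinite.
   Context: $\sigma_{k}(x_{1},\ldots,x_{m})=\sum_{1\le j_{1}<\cdots<j_{k}\le m}x_{j_{1}}\cdots x_{j_{k}}$ denotes the $k$-th elementary symmetric polynomial in $m$ variables. *)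

theory Defs
  imports
    Complex_Main
    "HOL-Library.FuncSet"
    "HOL-Library.Poly_Mapping"
    "HOL-Computational_Algebra.Fraction_Field"
begin

text \<open>
  Polynomials over the rationals in the variables \<open>t\<^sub>1, t\<^sub>2, \<dots>\<close>: a polynomial maps each monomial
  to its coefficient, and a monomial maps the index of each variable to its exponent.
\<close>

type_synonym qpoly = "(nat \<Rightarrow>\<^sub>0 nat) \<Rightarrow>\<^sub>0 rat"

definition qpoly_vars :: "nat \<Rightarrow> qpoly set" where
  "qpoly_vars m = {p. \<forall>u \<in> Poly_Mapping.keys p. Poly_Mapping.keys u \<subseteq> {1..m}}"

text \<open>
  Since the number of variables is not fixed by a type, the field \<open>\<rat>(t\<^sub>1, \<dots>, t\<^sub>m)\<close> is a subset
  (a subfield) of the field of fractions of \<open>\<rat>[t\<^sub>1, t\<^sub>2, \<dots>]\<close>.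
\<close>

definition ratfuns :: "nat \<Rightarrow> qpoly fract set" where
  "ratfuns m = {Fract p q | p q. p \<in> qpoly_vars m \<and> q \<in> qpoly_vars m \<and> q \<noteq> 0}"

text \<open>
  The choice of indices \<open>1 \<le> j\<^sub>1 < \<dots> < j\<^sub>k \<le> m\<close> is represented by the set \<open>{j\<^sub>1, \<dots>, j\<^sub>k}\<close>.
\<close>

definition elem_sym :: "nat \<Rightarrow> nat \<Rightarrow> (nat \<Rightarrow> 'a::comm_ring_1) \<Rightarrow> 'a" where
  "elem_sym k m x = (\<Sum>J | J \<subseteq> {1..m} \<and> card J = k. \<Prod>j\<in>J. x j)"

end

theory Submission
  imports Defs "HOL-Computational_Algebra.Polynomial" "HOL-Computational_Algebra.Primes"
begin

text \<open>
  Take \<open>x = (u, 1/u, v, 1/v, 1, \<dots>, 1)\<close> with rational \<open>u\<close> and \<open>v\<close>. Since this tuple is closed under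
  inversion, its product is \<open>1\<close> and \<open>\<sigma>\<^sub>i = \<sigma>\<^bsub>2n-i\<^esub>\<close>, and with \<open>s = u + 1/u\<close>, \<open>t = v + 1/v\<close> one has
  \<open>\<sigma>\<^sub>i = A + b (s + t) + g s t\<close> for natural numbers \<open>A\<close>, \<open>b\<close>, \<open>g\<close> depending only on \<open>i\<close> and \<open>n\<close>,
  where \<open>b\<close> and \<open>g\<close> are not both zero.

  The substitution \<open>u = (\<xi> + 1)/(\<xi> - 1)\<close>, \<open>v = (\<eta> + 1)/(\<eta> - 1)\<close> turns \<open>b (s + t) + g s t = c\<close> into an
  Edwards curve \<open>\<xi>\<^sup>2 + \<eta>\<^sup>2 = e + f \<xi>\<^sup>2 \<eta>\<^sup>2\<close>. If \<open>e\<close> is a 3-adic unit, \<open>f\<close> is 3-integral and 3 divides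
  \<open>\<xi>\<close>, then tripling a point raises the 3-adic valuation of \<open>\<xi>\<close> by exactly one, so one such point
  produces infinitely many. The choice \<open>u = 2\<close> (that is, \<open>\<xi> = 3\<close>) and \<open>v = 3\<^sup>N\<close> with \<open>N\<close> large gives a
  point on a curve of this kind, because then the valuation of \<open>c\<close> is so negative that \<open>e\<close> and \<open>f\<close>
  are congruent to \<open>1\<close> modulo 3. Different \<open>N\<close> give different values of \<open>c\<close>.
\<close>

section \<open>Rationals integral at 3 and their units\<close>

text \<open>This is the localization of the integers at the prime 3. The fractions need not be
  reduced, and \<open>q\<close> is nonzero because 3 does not divide it.\<close>

definition int3 :: "rat set" where
  "int3 = {of_int p / of_int q | p q. \<not> 3 dvd q}"

text \<open>The unit group of \<open>int3\<close>. A product \<open>3 ^ k * w\<close> with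
  \<open>w\<close> in \<open>unit3\<close> encodes 3-adic valuation exactly \<open>k\<close>, so no
  valuation function is introduced.\<close>

definition unit3 :: "rat set" where
  "unit3 = {of_int p / of_int q | p q. \<not> 3 dvd p \<and> \<not> 3 dvd q}"

lemma three_dvd_mult_iff: "3 dvd p * q \<longleftrightarrow> 3 dvd p \<or> 3 dvd q" for p q :: int
  by (rule prime_dvd_mult_iff) simp

lemma int3E:
  assumes "x \<in> int3"
  obtains p q where "x = of_int p / of_int q" "\<not> 3 dvd q" "q \<noteq> 0"
  using assms by (auto simp: int3_def)

lemma unit3E:
  assumes "x \<in> unit3"
  obtains p q where "x = of_int p / of_int q" "\<not> 3 dvd p" "\<not> 3 dvd q" "p \<noteq> 0" "q \<noteq> 0"
  using assms by (auto simp: unit3_def)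

lemma int3I: "\<not> 3 dvd q \<Longrightarrow> of_int p / of_int q \<in> int3"
  by (auto simp: int3_def)

lemma unit3I: "\<not> 3 dvd p \<Longrightarrow> \<not> 3 dvd q \<Longrightarrow> of_int p / of_int q \<in> unit3"
  by (auto simp: unit3_def)

lemma int3_add [intro]:
  assumes "x \<in> int3" "y \<in> int3"
  shows "x + y \<in> int3"
proof -
  obtain p q where x: "x = of_int p / of_int q" "\<not> 3 dvd q" "q \<noteq> 0"
    using assms(1) by (rule int3E)
  obtain r s where y: "y = of_int r / of_int s" "\<not> 3 dvd s" "s \<noteq> 0"
    using assms(2) by (rule int3E)
  have "x + y = of_int (p * s + r * q) / of_int (q * s)"
    using x(3) y(3) unfolding x(1) y(1) by (simp add: field_simps)
  also have "\<dots> \<in> int3"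
    using x y by (intro int3I) (simp add: three_dvd_mult_iff)
  finally show ?thesis .
qed

lemma int3_mult [intro]:
  assumes "x \<in> int3" "y \<in> int3"
  shows "x * y \<in> int3"
proof -
  obtain p q where x: "x = of_int p / of_int q" "\<not> 3 dvd q"
    using assms(1) by (rule int3E)
  obtain r s where y: "y = of_int r / of_int s" "\<not> 3 dvd s"
    using assms(2) by (rule int3E)
  have "x * y = of_int (p * r) / of_int (q * s)"
    using x y by simp
  also have "\<dots> \<in> int3"
    using x y by (intro int3I) (simp add: three_dvd_mult_iff)
  finally show ?thesis .
qed

lemma int3_of_int: "of_int p \<in> int3"
  using int3I[of 1 p] by simp

lemma int3_numeral [simp, intro]: "numeral k \<in> int3"
  using int3_of_int[of "numeral k"] by simp

lemma int3_1 [simp, intro]: "1 \<in> int3"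
  using int3_of_int[of 1] by simp

lemma int3_minus [intro]: "x \<in> int3 \<Longrightarrow> - x \<in> int3"
  using int3_mult[OF int3_of_int[of "-1"]] by simp

lemma int3_diff [intro]: "x \<in> int3 \<Longrightarrow> y \<in> int3 \<Longrightarrow> x - y \<in> int3"
  using int3_add[of x "- y"] by auto

lemma int3_power [intro]: "x \<in> int3 \<Longrightarrow> x ^ k \<in> int3"
  by (induction k) auto

lemma unit3_int3 [intro]: "x \<in> unit3 \<Longrightarrow> x \<in> int3"
  by (auto simp: unit3_def int3_def)

lemma unit3_nonzero: "x \<in> unit3 \<Longrightarrow> x \<noteq> 0"
  by (elim unit3E) simp

lemma unit3_mult [intro]:
  assumes "x \<in> unit3" "y \<in> unit3"
  shows "x * y \<in> unit3"
proof -
  obtain p q where x: "x = of_int p / of_int q" "\<not> 3 dvd p" "\<not> 3 dvd q"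
    using assms(1) by (rule unit3E)
  obtain r s where y: "y = of_int r / of_int s" "\<not> 3 dvd r" "\<not> 3 dvd s"
    using assms(2) by (rule unit3E)
  have "x * y = of_int (p * r) / of_int (q * s)"
    using x y by simp
  also have "\<dots> \<in> unit3"
    using x y by (intro unit3I) (simp_all add: three_dvd_mult_iff)
  finally show ?thesis .
qed

lemma unit3_inverse: "x \<in> unit3 \<Longrightarrow> inverse x \<in> unit3"
  by (elim unit3E) (metis inverse_divide unit3I)

lemma unit3_divide [intro]: "x \<in> unit3 \<Longrightarrow> y \<in> unit3 \<Longrightarrow> x / y \<in> unit3"
  using unit3_mult[OF _ unit3_inverse] by (simp add: divide_inverse)

lemma int3_divide [intro]: "x \<in> int3 \<Longrightarrow> y \<in> unit3 \<Longrightarrow> x / y \<in> int3"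
  using int3_mult[OF _ unit3_int3[OF unit3_inverse]] by (simp add: divide_inverse)

lemma unit3_minus [intro]: "x \<in> unit3 \<Longrightarrow> - x \<in> unit3"
  using unit3_mult[OF unit3I[of "-1" 1]] by simp

lemma unit3_1 [simp, intro]: "1 \<in> unit3"
  using unit3I[of 1 1] by simp

text \<open>A unit stays a unit under any change that vanishes modulo 3. Later unit claims are
  proved by bringing an expression into this shape.\<close>

lemma unit3_add_three_mult:
  assumes "x \<in> unit3" "y \<in> int3"
  shows "x + 3 * y \<in> unit3"
proof -
  obtain p q where x: "x = of_int p / of_int q" "\<not> 3 dvd p" "\<not> 3 dvd q" "q \<noteq> 0"
    using assms(1) by (rule unit3E)
  obtain r s where y: "y = of_int r / of_int s" "\<not> 3 dvd s" "s \<noteq> 0"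
    using assms(2) by (rule int3E)
  have "x + 3 * y = of_int (p * s + 3 * (r * q)) / of_int (q * s)"
    using x(4) y(3) unfolding x(1) y(1) by (simp add: field_simps)
  also have "\<dots> \<in> unit3"
    using x y by (intro unit3I) (simp_all add: three_dvd_mult_iff dvd_add_left_iff)
  finally show ?thesis .
qed

lemma three_mult_notin_unit3:
  assumes "y \<in> int3"
  shows "3 * y \<notin> unit3"
proof
  assume "3 * y \<in> unit3"
  then obtain p q where x: "3 * y = of_int p / of_int q" "\<not> 3 dvd p" "\<not> 3 dvd q" "q \<noteq> 0"
    by (rule unit3E)
  obtain r s where y: "y = of_int r / of_int s" "\<not> 3 dvd s" "s \<noteq> 0"
    using assms by (rule int3E)
  have "of_int (3 * (r * q)) = (of_int (p * s) :: rat)"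
    using x y by (simp add: field_simps)
  then have "3 * (r * q) = p * s"
    by (simp only: of_int_eq_iff)
  then have "3 dvd p * s"
    by (metis dvd_triv_left)
  with x y show False
    by (simp add: three_dvd_mult_iff)
qed

text \<open>Cancelling \<open>3 ^ k\<close> would make the unit \<open>w\<close> a multiple of 3.
  Used in both directions, this shows that the exponent is determined by the number.\<close>

lemma power3_mult_unit3_less:
  assumes "w \<in> unit3" "w' \<in> unit3" "3 ^ k * w = 3 ^ l * w'"
  shows "\<not> k < l"
proof
  assume "k < l"
  then obtain d where "l = Suc (k + d)"
    by (metis less_iff_Suc_add)
  with assms(3) have "w = 3 * (3 ^ d * w')"
    by (simp add: power_add mult_ac)
  moreover have "3 * (3 ^ d * w') \<notin> unit3"
    using assms(2) by (intro three_mult_notin_unit3) auto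
  ultimately show False
    using assms(1) by simp
qed

section \<open>Tripling on an Edwards curve and 3-adic valuations\<close>

text \<open>
  For a square \<open>e\<close>, the map is multiplication by 3 on the Edwards curve after dividing both coordinates
  by \<open>\<surd>e\<close>; only even powers of \<open>\<surd>e\<close> survive, so the formula makes sense for all \<open>e\<close>.
\<close>

lemma edwards_triple:
  fixes e f \<xi> \<eta> :: "'a::field"
  defines "N1 \<equiv> (\<xi>^2 + \<eta>^2)^2 - 4 * e * \<eta>^2" and "N2 \<equiv> (\<xi>^2 + \<eta>^2)^2 - 4 * e * \<xi>^2"
    and "D1 \<equiv> 4 * (\<xi>^2 - e) * \<xi>^2 - (\<xi>^2 - \<eta>^2)^2"
    and "D2 \<equiv> 4 * (e - \<eta>^2) * \<eta>^2 + (\<xi>^2 - \<eta>^2)^2"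
  assumes curve: "\<xi>^2 + \<eta>^2 = e + f * \<xi>^2 * \<eta>^2"
    and nz: "D1 \<noteq> 0" "D2 \<noteq> 0"
  shows "(\<xi> * N1 / D1)^2 + (\<eta> * N2 / D2)^2 = e + f * (\<xi> * N1 / D1)^2 * (\<eta> * N2 / D2)^2"
proof -
  \<comment> \<open>With \<open>f * \<xi>^2 * \<eta>^2\<close> replaced by
    \<open>\<xi>^2 + \<eta>^2 - e\<close>, the claim is free of \<open>f\<close> and becomes a
    polynomial identity, valid off the curve too.\<close>
  have "\<xi>^2 * N1^2 * D2^2 + \<eta>^2 * N2^2 * D1^2 =
      e * D2^2 * D1^2 + (\<xi>^2 + \<eta>^2 - e) * N1^2 * N2^2"
    unfolding N1_def N2_def D1_def D2_def by algebra
  also have "\<xi>^2 + \<eta>^2 - e = f * \<xi>^2 * \<eta>^2"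
    using curve by simp
  finally have "(\<xi>^2 * N1^2 * D2^2 + \<eta>^2 * N2^2 * D1^2) / (D1^2 * D2^2) =
      (e * D2^2 * D1^2 + f * \<xi>^2 * \<eta>^2 * N1^2 * N2^2) / (D1^2 * D2^2)"
    by simp
  then show ?thesis
    using nz by (simp add: power_mult_distrib power_divide add_divide_distrib mult_ac)
qed

text \<open>Modulo 9 one has \<open>\<xi>^2 = 0\<close>, hence \<open>\<eta>^2 = e\<close> by the
  curve equation. Then \<open>N1\<close> is congruent to \<open>-3 * e^2\<close>, \<open>D1\<close>
  to \<open>-e^2\<close> and \<open>D2\<close> to \<open>e^2\<close>: the numerator gains exactly
  one factor 3 and both denominators are units.\<close>

lemma edwards_triple_unit3:
  assumes e: "e \<in> unit3" and f: "f \<in> int3" and w: "w \<in> unit3" and "1 \<le> k"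
    and curve: "(3 ^ k * w)^2 + \<eta>^2 = e + f * (3 ^ k * w)^2 * \<eta>^2"
  shows "\<exists>w' \<in> unit3. \<exists>\<eta>'. (3 ^ Suc k * w')^2 + \<eta>'^2 = e + f * (3 ^ Suc k * w')^2 * \<eta>'^2"
proof -
  define \<xi> where "\<xi> = 3 ^ k * w"
  define N1 where "N1 = (\<xi>^2 + \<eta>^2)^2 - 4 * e * \<eta>^2"
  define N2 where "N2 = (\<xi>^2 + \<eta>^2)^2 - 4 * e * \<xi>^2"
  define D1 where "D1 = 4 * (\<xi>^2 - e) * \<xi>^2 - (\<xi>^2 - \<eta>^2)^2"
  define D2 where "D2 = 4 * (e - \<eta>^2) * \<eta>^2 + (\<xi>^2 - \<eta>^2)^2"
  define x where "x = (3 ^ (k - 1) * w)^2"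
  have X: "\<xi>^2 = 9 * x"
    using \<open>1 \<le> k\<close> by (cases k) (simp_all add: \<xi>_def x_def power_mult_distrib)
  have x: "x \<in> int3"
    unfolding x_def using w by auto
  \<comment> \<open>\<open>h\<close> is \<open>1 - f * \<xi>^2\<close>, the factor of
    \<open>\<eta>^2\<close> when the curve equation is solved for it; \<open>y\<close> below is the
    resulting \<open>(\<eta>^2 - e) / 9\<close>.\<close>
  define h where "h = 1 + 3 * (- (3 * f * x))"
  have h: "h \<in> unit3"
    unfolding h_def using x f by (intro unit3_add_three_mult int3_add int3_diff int3_mult int3_power int3_minus) auto
  define y where "y = x * (e * f - 1) / h"
  have y: "y \<in> int3"
    unfolding y_def using x e f h by (intro int3_divide int3_mult int3_diff) auto
  have "\<eta>^2 * h = e - 9 * x"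
    using curve unfolding h_def \<xi>_def[symmetric] X by (simp add: algebra_simps)
  also have "\<dots> = (e + 9 * y) * h"
    using unit3_nonzero[OF h] by (simp add: y_def distrib_right) (simp add: h_def algebra_simps)
  finally have Y: "\<eta>^2 = e + 9 * y"
    using unit3_nonzero[OF h] by simp
  define n where "n = - (e * e) + 3 * (2 * e * (x + y) + 9 * (x + y)^2 - 4 * e * y)"
  have N1: "N1 = 3 * n"
    unfolding N1_def X Y n_def by algebra
  have n: "n \<in> unit3"
    unfolding n_def using e x y by (intro unit3_add_three_mult int3_add int3_diff int3_mult int3_power int3_minus) auto
  have "D1 = - (e * e) + 3 * (12 * x * (9 * x - e) + 6 * e * (x - y) - 27 * (x - y)^2)"
    unfolding D1_def X Y by algebra
  also have "\<dots> \<in> unit3"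
    using e x y by (intro unit3_add_three_mult int3_add int3_diff int3_mult int3_power int3_minus) auto
  finally have D1: "D1 \<in> unit3" .
  have "D2 = e * e + 3 * (- (12 * y * (e + 9 * y)) - 6 * e * (x - y) + 27 * (x - y)^2)"
    unfolding D2_def X Y by algebra
  also have "\<dots> \<in> unit3"
    using e x y by (intro unit3_add_three_mult int3_add int3_diff int3_mult int3_power int3_minus) auto
  finally have D2: "D2 \<in> unit3" .
  have "\<xi> * N1 / D1 = 3 ^ Suc k * (w * n / D1)"
    by (simp add: \<xi>_def N1)
  moreover have "(\<xi> * N1 / D1)^2 + (\<eta> * N2 / D2)^2 = e + f * (\<xi> * N1 / D1)^2 * (\<eta> * N2 / D2)^2"
    using curve unit3_nonzero[OF D1] unit3_nonzero[OF D2]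
    unfolding N1_def N2_def D1_def D2_def \<xi>_def[symmetric] by (rule edwards_triple)
  moreover have "w * n / D1 \<in> unit3"
    using w n D1 by auto
  ultimately show ?thesis
    by metis
qed

text \<open>Iterated tripling from \<xi> = 3 reaches every valuation from 1 upwards, and points with
  different valuations have different \<xi>.\<close>

lemma infinite_edwards:
  assumes e: "e \<in> unit3" and f: "f \<in> int3" and start: "3^2 + \<eta>^2 = e + f * 3^2 * \<eta>^2"
  shows "infinite {\<xi>. \<exists>\<eta>. \<xi>^2 + \<eta>^2 = e + f * \<xi>^2 * \<eta>^2}" (is "infinite ?S")
proof -
  have "\<exists>w \<in> unit3. 3 ^ Suc k * w \<in> ?S" for k
  proof (induction k)
    case 0
    show ?case
      using start by (intro bexI[of _ 1]) auto
  next
    case (Suc k)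
    then show ?case
      using edwards_triple_unit3[OF e f, of _ "Suc k"] by auto
  qed
  then have "\<forall>k. \<exists>w. w \<in> unit3 \<and> 3 ^ Suc k * w \<in> ?S"
    by blast
  then obtain w where "\<forall>k. w k \<in> unit3 \<and> 3 ^ Suc k * w k \<in> ?S"
    by (rule choice[THEN exE])
  then have w: "w k \<in> unit3" "3 ^ Suc k * w k \<in> ?S" for k
    by blast+
  have "inj (\<lambda>k. 3 ^ Suc k * w k)"
  proof (rule injI)
    fix k l assume eq: "3 ^ Suc k * w k = 3 ^ Suc l * w l"
    show "k = l"
      using power3_mult_unit3_less[OF w(1) w(1) eq] power3_mult_unit3_less[OF w(1) w(1) eq[symmetric]]
      by simp
  qed
  then have "infinite (range (\<lambda>k. 3 ^ Suc k * w k))"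
    by (rule range_inj_infinite)
  moreover have "range (\<lambda>k. 3 ^ Suc k * w k) \<subseteq> ?S"
    using w(2) by blast
  ultimately show ?thesis
    using infinite_super by blast
qed

section \<open>From the symmetric equation to the Edwards curve\<close>

text \<open>Since \<open>u + 1 / u = 2 * (\<xi>^2 + 1) / (\<xi>^2 - 1)\<close>, only squares occur.
  Left minus right side of each equation has the same numerator, over
  \<open>(X - 1) * (Y - 1)\<close> in one case and over \<open>m\<close> in the other.\<close>

lemma cayley_symmetric_iff_edwards:
  fixes \<beta> \<gamma> c \<xi> \<eta> u v :: rat
  assumes "c + 4 * \<gamma> \<noteq> 0" and "\<xi>^2 \<noteq> 1" "\<eta>^2 \<noteq> 1"
    and u: "u = (\<xi> + 1) / (\<xi> - 1)" and v: "v = (\<eta> + 1) / (\<eta> - 1)"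
  shows "\<beta> * ((u + 1 / u) + (v + 1 / v)) + \<gamma> * ((u + 1 / u) * (v + 1 / v)) = c \<longleftrightarrow>
    \<xi>^2 + \<eta>^2 = (c + 4 * \<beta> - 4 * \<gamma>) / (c + 4 * \<gamma>)
      + (c - 4 * \<beta> - 4 * \<gamma>) / (c + 4 * \<gamma>) * \<xi>^2 * \<eta>^2"
proof -
  have s: "(t + 1) / (t - 1) + 1 / ((t + 1) / (t - 1)) = 2 * (t^2 + 1) / (t^2 - 1)"
    if "t^2 \<noteq> 1" for t :: rat
  proof -
    have "t + 1 \<noteq> 0" "t - 1 \<noteq> 0" "t^2 - 1 \<noteq> 0"
      using that by (auto simp: power2_eq_1_iff eq_neg_iff_add_eq_0)
    then show ?thesis
      by (simp add: field_simps power2_eq_square)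
  qed
  define X Y m where "X = \<xi>^2" and "Y = \<eta>^2" and "m = c + 4 * \<gamma>"
  have nz: "X - 1 \<noteq> 0" "Y - 1 \<noteq> 0" "m \<noteq> 0"
    using assms by (auto simp: X_def Y_def m_def)
  have "\<beta> * (2 * (X + 1) / (X - 1) + 2 * (Y + 1) / (Y - 1)) +
      \<gamma> * ((2 * (X + 1) / (X - 1)) * (2 * (Y + 1) / (Y - 1))) - c =
     (m * (X + Y) - (c + 4 * \<beta> - 4 * \<gamma>) - (c - 4 * \<beta> - 4 * \<gamma>) * X * Y) / ((X - 1) * (Y - 1))"
    using nz by (simp add: divide_simps) (simp add: m_def algebra_simps)
  moreover have "X + Y - ((c + 4 * \<beta> - 4 * \<gamma>) / m + (c - 4 * \<beta> - 4 * \<gamma>) / m * X * Y) =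
     (m * (X + Y) - (c + 4 * \<beta> - 4 * \<gamma>) - (c - 4 * \<beta> - 4 * \<gamma>) * X * Y) / m"
    using nz by (simp add: divide_simps)
  ultimately have "\<beta> * (2 * (X + 1) / (X - 1) + 2 * (Y + 1) / (Y - 1)) +
      \<gamma> * ((2 * (X + 1) / (X - 1)) * (2 * (Y + 1) / (Y - 1))) - c = 0 \<longleftrightarrow>
      X + Y - ((c + 4 * \<beta> - 4 * \<gamma>) / m + (c - 4 * \<beta> - 4 * \<gamma>) / m * X * Y) = 0"
    using nz by (simp only: divide_eq_0_iff mult_eq_0_iff) simp
  then show ?thesis
    unfolding u v s[OF assms(2)] s[OF assms(3)] X_def[symmetric] Y_def[symmetric] m_def[symmetric]
    by simp
qed

lemma infinite_symmetric_curve: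
  fixes \<beta> \<gamma> c v\<^sub>0 :: rat
  assumes nn: "0 \<le> \<beta>" "0 \<le> \<gamma>" "\<beta> \<noteq> 0 \<or> \<gamma> \<noteq> 0" and "0 < c"
    and e: "(c + 4 * \<beta> - 4 * \<gamma>) / (c + 4 * \<gamma>) \<in> unit3"
    and f: "(c - 4 * \<beta> - 4 * \<gamma>) / (c + 4 * \<gamma>) \<in> int3"
    and start: "\<beta> * (5 / 2 + (v\<^sub>0 + 1 / v\<^sub>0)) + \<gamma> * (5 / 2 * (v\<^sub>0 + 1 / v\<^sub>0)) = c"
    and "1 < v\<^sub>0"
  shows "infinite {u. u \<noteq> 0 \<and> (\<exists>v. v \<noteq> 0 \<and>
    \<beta> * ((u + 1 / u) + (v + 1 / v)) + \<gamma> * ((u + 1 / u) * (v + 1 / v)) = c)}" (is "infinite ?U")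
proof -
  define e where "e = (c + 4 * \<beta> - 4 * \<gamma>) / (c + 4 * \<gamma>)"
  define f where "f = (c - 4 * \<beta> - 4 * \<gamma>) / (c + 4 * \<gamma>)"
  define S where "S = {\<xi>. \<exists>\<eta>. \<xi>^2 + \<eta>^2 = e + f * \<xi>^2 * \<eta>^2}"
  \<comment> \<open>Setting \<eta>^2 = 1 in the curve equation forces \<xi>^2 = z. Such \<xi> are
    discarded, since \<eta> = 1 or -1 gives no nonzero finite \<open>v\<close>.\<close>
  define z where "z = (\<beta> - 2 * \<gamma>) / (\<beta> + 2 * \<gamma>)"
  define \<eta>\<^sub>0 where "\<eta>\<^sub>0 = (v\<^sub>0 + 1) / (v\<^sub>0 - 1)"
  have pos: "c + 4 * \<gamma> \<noteq> 0" "\<beta> + 2 * \<gamma> \<noteq> 0"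
    using nn \<open>0 < c\<close> by auto
  have "\<eta>\<^sub>0 > 1"
    using \<open>1 < v\<^sub>0\<close> by (simp add: \<eta>\<^sub>0_def)
  then have "\<eta>\<^sub>0^2 \<noteq> 1"
    by (auto simp: power2_eq_1_iff)
  \<comment> \<open>The Cayley map is its own inverse, and it sends 3 to 2; this accounts for the
    \<open>5 / 2 = 2 + 1 / 2\<close> in the hypothesis on \<open>v\<^sub>0\<close>.\<close>
  moreover have "v\<^sub>0 = (\<eta>\<^sub>0 + 1) / (\<eta>\<^sub>0 - 1)"
    using \<open>1 < v\<^sub>0\<close> by (simp add: \<eta>\<^sub>0_def field_simps)
  ultimately have "3^2 + \<eta>\<^sub>0^2 = e + f * 3^2 * \<eta>\<^sub>0^2"
    using cayley_symmetric_iff_edwards[of c \<gamma> 3 \<eta>\<^sub>0 2 v\<^sub>0 \<beta>] pos start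
    by (simp add: e_def f_def)
  then have "infinite S"
    unfolding S_def using e f by (intro infinite_edwards) (simp_all only: e_def f_def)
  moreover have "finite {\<xi> :: rat. \<xi>^2 = 1}"
    by (rule finite_subset[of _ "{1, -1}"]) (auto simp: power2_eq_1_iff)
  moreover have "finite {\<xi> :: rat. \<xi>^2 = z}"
  proof (cases "\<exists>r. r^2 = z")
    case True
    then obtain r where "r^2 = z" by blast
    then have "{\<xi>. \<xi>^2 = z} \<subseteq> {r, -r}"
      by (auto simp: power2_eq_iff)
    then show ?thesis
      by (rule finite_subset) simp
  qed simp
  ultimately have "infinite (S - ({\<xi>. \<xi>^2 = 1} \<union> {\<xi>. \<xi>^2 = z}))" (is "infinite ?T")
    by (intro Diff_infinite_finite) auto
  moreover have "inj_on (\<lambda>\<xi>. (\<xi> + 1) / (\<xi> - 1)) ?T"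
  proof (rule inj_onI)
    fix s t assume st: "s \<in> ?T" "t \<in> ?T" "(s + 1) / (s - 1) = (t + 1) / (t - 1)"
    then have "s - 1 \<noteq> 0" "t - 1 \<noteq> 0"
      by auto
    with st(3) show "s = t"
      by (simp add: field_simps)
  qed
  ultimately have "infinite ((\<lambda>\<xi>. (\<xi> + 1) / (\<xi> - 1)) ` ?T)"
    using finite_imageD by blast
  moreover have "(\<lambda>\<xi>. (\<xi> + 1) / (\<xi> - 1)) ` ?T \<subseteq> ?U"
  proof (rule image_subsetI)
    fix \<xi> assume "\<xi> \<in> ?T"
    then have "\<xi> \<in> S" and \<xi>1: "\<xi>^2 \<noteq> 1" and \<xi>z: "\<xi>^2 \<noteq> z"
      by auto
    from this(1) obtain \<eta> where \<eta>: "\<xi>^2 + \<eta>^2 = e + f * \<xi>^2 * \<eta>^2"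
      by (auto simp: S_def)
    have "\<eta>^2 \<noteq> 1"
    proof
      assume "\<eta>^2 = 1"
      with \<eta> have "\<xi>^2 * (1 - f) = e - 1"
        by (simp add: algebra_simps)
      moreover have "1 - f = 4 * (\<beta> + 2 * \<gamma>) / (c + 4 * \<gamma>)" "e - 1 = 4 * (\<beta> - 2 * \<gamma>) / (c + 4 * \<gamma>)"
        using pos by (simp_all add: e_def f_def field_simps)
      ultimately have "\<xi>^2 * (\<beta> + 2 * \<gamma>) = \<beta> - 2 * \<gamma>"
        using pos by (simp add: field_simps)
      with \<xi>z pos show False
        by (simp add: z_def field_simps)
    qed
    moreover from this have "(\<eta> + 1) / (\<eta> - 1) \<noteq> 0"
      by (auto simp: power2_eq_1_iff eq_neg_iff_add_eq_0)
    moreover have "(\<xi> + 1) / (\<xi> - 1) \<noteq> 0"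
      using \<xi>1 by (auto simp: power2_eq_1_iff eq_neg_iff_add_eq_0)
    ultimately show "(\<xi> + 1) / (\<xi> - 1) \<in> ?U"
      using cayley_symmetric_iff_edwards[OF pos(1) \<xi>1 _ refl refl, of \<eta> \<beta>] \<eta>
      unfolding e_def[symmetric] f_def[symmetric] by blast
  qed
  ultimately show ?thesis
    using infinite_super by blast
qed

section \<open>Infinitely many admissible right-hand sides\<close>

text \<open>For \<open>u = 2\<close> the left side is
  \<open>5 * b / 2 + D / 2 * (v + 1 / v)\<close>. If \<open>v\<close> is a power of 3 beyond the
  power dividing \<open>D\<close>, the term \<open>D / (2 * v)\<close> dominates 3-adically. Adding
  a 3-integral number to \<open>c\<close> then changes it only by a factor congruent to 1 modulo
  3.\<close>

lemma infinite_values_symmetric_curve: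
  fixes b g :: nat
  assumes "b \<noteq> 0 \<or> g \<noteq> 0"
  shows "infinite {c :: rat. 0 < c \<and> infinite {u. u \<noteq> 0 \<and> (\<exists>v. v \<noteq> 0 \<and>
    of_nat b * ((u + 1 / u) + (v + 1 / v)) + of_nat g * ((u + 1 / u) * (v + 1 / v)) = c)}}"
    (is "infinite ?C")
proof -
  define D where "D = 2 * b + 5 * g"
  have "D \<noteq> 0"
    using assms by (auto simp: D_def)
  then obtain d where D: "D = 3 ^ multiplicity 3 D * d" "\<not> 3 dvd d"
    by (rule multiplicity_decompose'[of D 3]) auto
  define r where "r = multiplicity 3 D"
  define v :: "nat \<Rightarrow> rat" where "v j = 3 ^ (Suc (r + j))" for j
  define c where "c j = of_nat b * (5 / 2 + (v j + 1 / v j)) + of_nat g * (5 / 2 * (v j + 1 / v j))" for j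
  \<comment> \<open>\<open>k j\<close> is \<open>c j * (6 * 3 ^ j)\<close>, a unit because it is
    congruent to \<open>d\<close> modulo 3; so \<open>c j\<close> has valuation
    \<open>-(j + 1)\<close>.\<close>
  define k :: "nat \<Rightarrow> rat" where
    "k j = of_nat d + 3 * (5 * of_nat b * 3 ^ j + 3 * of_nat d * 9 ^ (r + j))" for j
  have v1: "1 < v j" for j
    unfolding v_def by (rule one_less_power) auto
  have c_D: "c j = of_nat b * (5 / 2) + of_nat D / 2 * (v j + 1 / v j)" for j
    by (simp add: c_def D_def algebra_simps)
  have d: "of_nat d \<in> unit3"
  proof -
    have "\<not> 3 dvd int d"
      using D(2) by presburger
    then show ?thesis
      using unit3I[of "int d" 1] by simp
  qed
  have nat: "of_nat m \<in> int3" for m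
    using int3_of_int[of "int m"] by simp
  have k: "k j \<in> unit3" for j
    unfolding k_def using d nat by (intro unit3_add_three_mult int3_add int3_mult int3_power) auto
  have ck: "c j + 4 * x = (k j + 3 * (8 * 3 ^ j * x)) / (6 * 3 ^ j)" for j x
  proof -
    have v9: "v j * v j = 9 * 9 ^ r * 9 ^ j"
    proof -
      have "(3 :: rat) ^ a * 3 ^ a = 9 ^ a" for a
        by (simp add: power_mult_distrib[symmetric])
      from this[of "Suc (r + j)"] show ?thesis
        by (simp add: v_def power_add)
    qed
    have "6 * 3 ^ j * 3 ^ r = 2 * v j"
      by (simp add: v_def power_add)
    then have "3 ^ r * (c j * (6 * 3 ^ j)) = 2 * v j * c j"
      by (simp add: mult_ac)
    also have "\<dots> = 5 * of_nat b * v j + of_nat D * (v j * v j + 1)"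
      using v1[of j] unfolding c_D by (simp add: field_simps)
    also have "\<dots> = 3 ^ r * k j"
      unfolding v9 D(1)[folded r_def] by (simp add: v_def k_def power_add algebra_simps)
    finally have "c j * (6 * 3 ^ j) = k j"
      by simp
    then show ?thesis
      by (simp add: field_simps)
  qed
  have "c j \<in> ?C" for j
  proof -
    have u: "c j + 4 * x = (k j + 3 * (8 * 3 ^ j * x)) / (6 * 3 ^ j) \<and> k j + 3 * (8 * 3 ^ j * x) \<in> unit3"
      if "x \<in> int3" for x
      using that k by (intro conjI ck unit3_add_three_mult int3_mult int3_power) auto
    have quot: "(c j + 4 * x) / (c j + 4 * y) \<in> unit3" if "x \<in> int3" "y \<in> int3" for x y
      using u[OF that(1)] u[OF that(2)] by auto
    have "0 < c j"
      using v1[of j] \<open>D \<noteq> 0\<close> unfolding c_D by (intro add_nonneg_pos mult_pos_pos) auto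
    moreover have "(c j + 4 * of_nat b - 4 * of_nat g) / (c j + 4 * of_nat g) \<in> unit3"
      using quot[of "of_nat b - of_nat g" "of_nat g"] nat by (auto simp: algebra_simps)
    moreover have "(c j - 4 * of_nat b - 4 * of_nat g) / (c j + 4 * of_nat g) \<in> int3"
      using quot[of "- of_nat b - of_nat g" "of_nat g"] nat by (auto simp: algebra_simps)
    ultimately show ?thesis
      using infinite_symmetric_curve[of "of_nat b" "of_nat g" "c j" "v j"] assms v1[of j]
      by (auto simp: c_def)
  qed
  moreover have "inj c"
  proof (rule strict_mono_imp_inj_on, rule strict_mono_Suc_iff[THEN iffD2], rule allI)
    fix j
    have "v (Suc j) = 3 * v j"
      by (simp add: v_def)
    \<comment> \<open>Distinctness of the \<open>c j\<close> comes from real order, not from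
      valuations: \<open>v + 1 / v\<close> grows when \<open>v > 1\<close> is tripled.\<close>
    then have "v (Suc j) + 1 / v (Suc j) - (v j + 1 / v j) = 2 * (v j - 1 / (3 * v j))"
      using v1[of j] by (simp add: field_simps)
    moreover have "1 / (3 * v j) < v j"
      using v1[of j] less_trans[of "1 / (3 * v j)" 1 "v j"] by simp
    ultimately have "v j + 1 / v j < v (Suc j) + 1 / v (Suc j)"
      by simp
    then show "c j < c (Suc j)"
      unfolding c_D using \<open>D \<noteq> 0\<close> by simp
  qed
  ultimately show ?thesis
    using infinite_super[of "range c" ?C] range_inj_infinite by blast
qed

section \<open>Generating polynomial of the elementary symmetric functions\<close>

text \<open>Expanding the product over subsets, \<open>J\<close> contributes a monomial of degree
  \<open>card J\<close>.\<close>

lemma coeff_prod_linear_eq_elem_sym: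
  fixes x :: "nat \<Rightarrow> 'a::comm_ring_1"
  shows "coeff (\<Prod>j\<in>{1..m}. [:1, x j:]) k = elem_sym k m x"
proof -
  have monom: "(\<Prod>j\<in>J. monom (x j) 1) = monom (\<Prod>j\<in>J. x j) (card J)" for J
    by (induction J rule: infinite_finite_induct) (simp_all add: mult_monom)
  have "(\<Prod>j\<in>{1..m}. [:1, x j:]) = (\<Prod>j\<in>{1..m}. monom (x j) 1 + 1)"
    by (simp add: monom_altdef one_pCons)
  also have "\<dots> = (\<Sum>J\<in>Pow {1..m}. monom (\<Prod>j\<in>J. x j) (card J))"
    unfolding prod_add[OF finite_atLeastAtMost] by (simp only: monom prod.neutral_const mult_1_right)
  finally have "coeff (\<Prod>j\<in>{1..m}. [:1, x j:]) k =
      (\<Sum>J\<in>Pow {1..m}. if card J = k then \<Prod>j\<in>J. x j else 0)"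
    by (simp add: coeff_sum)
  also have "\<dots> = (\<Sum>J | J \<in> Pow {1..m} \<and> card J = k. \<Prod>j\<in>J. x j)"
    by (rule sum.inter_filter[symmetric]) simp
  finally show ?thesis
    by (simp add: elem_sym_def)
qed

text \<open>Serves to make the constants \<open>A\<close>, \<open>b\<close>, \<open>g\<close>
  natural, which yields their nonnegativity and the 3-integrality of \<open>b\<close> and
  \<open>g\<close>.\<close>

lemma coeff_mult_Nats:
  fixes p q :: "'a::comm_semiring_1 poly"
  assumes "\<And>k. coeff p k \<in> \<nat>" "\<And>k. coeff q k \<in> \<nat>"
  shows "coeff (p * q) k \<in> \<nat>"
proof -
  have "sum h A \<in> \<nat>" if "\<And>a. h a \<in> \<nat>" for h :: "nat \<Rightarrow> 'a" and A
    using that by (induction A rule: infinite_finite_induct) auto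
  then show ?thesis
    unfolding coeff_mult using assms by simp
qed

section \<open>Rational constants inside the function field\<close>

definition const :: "rat \<Rightarrow> qpoly fract" where
  "const r = Fract (Poly_Mapping.single 0 r) 1"

lemma const_0 [simp]: "const 0 = 0" and const_1 [simp]: "const 1 = 1"
  by (simp_all add: const_def Zero_fract_def One_fract_def)

lemma const_add: "const (x + y) = const x + const y"
  by (simp add: const_def single_add)

lemma const_mult: "const (x * y) = const x * const y"
  by (simp add: const_def mult_single)

lemma const_eq_iff [simp]: "const x = const y \<longleftrightarrow> x = y"
  by (simp add: const_def eq_fract inj_eq[OF inj_single])

lemma const_ratfuns: "const r \<in> ratfuns m"
proof -
  have "Poly_Mapping.single 0 r \<in> qpoly_vars m" "(1 :: qpoly) \<in> qpoly_vars m"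
    by (simp_all add: qpoly_vars_def)
  then show ?thesis
    unfolding ratfuns_def const_def by force
qed

lemma const_sum: "const (sum h A) = (\<Sum>a\<in>A. const (h a))"
  by (induction A rule: infinite_finite_induct) (simp_all add: const_add)

lemma const_prod: "const (prod h A) = (\<Prod>a\<in>A. const (h a))"
  by (induction A rule: infinite_finite_induct) (simp_all add: const_mult)

text \<open>\<open>const\<close> is a ring homomorphism. The restricted lambda matches the
  extensional function space of solutions, and the sum reads only indices in
  \<open>{1..m}\<close>.\<close>

lemma elem_sym_const:
  "elem_sym k m (\<lambda>j\<in>{1..m}. const (x j)) = const (elem_sym k m x)"
  unfolding elem_sym_def const_sum const_prod
  by (intro sum.cong prod.cong refl) auto

section \<open>Symmetric functions of two reciprocal pairs and ones\<close>

text \<open>The generating polynomial is (1 + sX + X^2)(1 + tX + X^2)(1 + X)^(2n-4), which is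
  palindromic with constant term 1. Expanding the quadratics in s + t and st gives \<open>A\<close>,
  \<open>b\<close> and \<open>g\<close>. The clause \<open>x 1 = u\<close> later separates
  solutions.\<close>

lemma elem_sym_reciprocal_pairs:
  assumes "1 \<le> i" "i \<le> n" "2 \<le> n"
  obtains A :: rat and b g :: nat where "0 \<le> A" "b \<noteq> 0 \<or> g \<noteq> 0"
    "\<And>u v :: rat. u \<noteq> 0 \<Longrightarrow> v \<noteq> 0 \<Longrightarrow> \<exists>x. x 1 = u \<and>
       elem_sym i (2 * n) x = A + (of_nat b * ((u + 1 / u) + (v + 1 / v)) + of_nat g * ((u + 1 / u) * (v + 1 / v))) \<and>
       elem_sym (2 * n - i) (2 * n) x = elem_sym i (2 * n) x \<and> elem_sym (2 * n) (2 * n) x = 1"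
proof -
  define Q :: "rat poly" where "Q = [:1, 1:] ^ (2 * n - 4)"
  have Q: "coeff Q k \<in> \<nat>" for k
  proof -
    have "coeff ([:1, 1:] ^ m :: rat poly) k \<in> \<nat>" for m k
    proof (induction m arbitrary: k)
      case (Suc m)
      then show ?case
        unfolding power_Suc by (intro coeff_mult_Nats) (auto simp: coeff_pCons split: nat.split)
    qed auto
    then show ?thesis
      by (simp add: Q_def)
  qed
  define A where "A = coeff (Q * [:1, 0, 2, 0, 1:]) i"
  have "A \<in> \<nat>"
    unfolding A_def using Q by (intro coeff_mult_Nats) (auto simp: coeff_pCons split: nat.split)
  then have "0 \<le> A"
    by (auto elim: Nats_cases)
  have "coeff (Q * [:0, 1, 0, 1:]) i \<in> \<nat>"
    using Q by (intro coeff_mult_Nats) (auto simp: coeff_pCons split: nat.split)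
  then obtain b where b: "coeff (Q * [:0, 1, 0, 1:]) i = of_nat b"
    by (auto elim: Nats_cases)
  have "coeff (Q * [:0, 0, 1:]) i \<in> \<nat>"
    using Q by (intro coeff_mult_Nats) (auto simp: coeff_pCons split: nat.split)
  then obtain g where g: "coeff (Q * [:0, 0, 1:]) i = of_nat g"
    by (auto elim: Nats_cases)
  \<comment> \<open>For \<open>i = 1\<close>, \<open>b\<close> is the constant term 1 of
    \<open>Q\<close>. For larger \<open>i\<close>, \<open>g\<close> is the binomial coefficient of
    2n - 4 over i - 2, nonzero because \<open>i \<le> n\<close> and
    \<open>2 \<le> n\<close>.\<close>
  have bg: "b \<noteq> 0 \<or> g \<noteq> 0"
  proof (cases "i = 1")
    case True
    have "coeff (Q * [:0, 1, 0, 1:]) 1 = 1"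
      by (simp add: coeff_mult Q_def coeff_0_power)
    then show ?thesis
      using b True by auto
  next
    case False
    with \<open>1 \<le> i\<close> have "i = Suc (Suc (i - 2))"
      by simp
    then obtain k where k: "i = Suc (Suc k)"
      by blast
    then have "k \<le> 2 * n - 4"
      using assms by simp
    then have "coeff Q k \<noteq> 0"
      by (simp add: Q_def coeff_linear_poly_power)
    then show ?thesis
      using g k by auto
  qed
  have "\<exists>x. x 1 = u \<and>
       elem_sym i (2 * n) x = A + (of_nat b * ((u + 1 / u) + (v + 1 / v)) + of_nat g * ((u + 1 / u) * (v + 1 / v))) \<and>
       elem_sym (2 * n - i) (2 * n) x = elem_sym i (2 * n) x \<and> elem_sym (2 * n) (2 * n) x = 1"
    if uv: "u \<noteq> 0" "v \<noteq> 0" for u v :: rat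
  proof (intro exI conjI)
    define x where "x = (\<lambda>j::nat. if j = 1 then u else if j = 2 then 1 / u else if j = 3 then v else if j = 4 then 1 / v else 1)"
    define s where "s = u + 1 / u"
    define t where "t = v + 1 / v"
    define G where "G = (\<Prod>j\<in>{1..2*n}. [:1, x j:])"
    have "{1..2*n} = {1, 2, 3, 4} \<union> {5..2*n}"
      using \<open>2 \<le> n\<close> by auto
    then have "G = (\<Prod>j\<in>{1, 2, 3, 4}. [:1, x j:]) * (\<Prod>j\<in>{5..2*n}. [:1, x j:])"
      unfolding G_def by (simp only:) (rule prod.union_disjoint, auto)
    also have "(\<Prod>j\<in>{5..2*n}. [:1, x j:]) = (\<Prod>j\<in>{5..2*n}. [:1, 1:])"
      by (rule prod.cong) (auto simp: x_def)
    also have "\<dots> = Q"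
      by (simp add: Q_def)
    also have "(\<Prod>j\<in>{1, 2, 3, 4}. [:1, x j:]) = [:1, s, 1:] * [:1, t, 1:]"
      using uv by (simp add: x_def s_def t_def algebra_simps)
    finally have G: "G = [:1, s, 1:] * [:1, t, 1:] * Q" .
    have "[:1, s, 1:] * [:1, t, 1:] = [:1, 0, 2, 0, 1:] + smult (s + t) [:0, 1, 0, 1:] + smult (s * t) [:0, 0, 1:]"
      by simp
    then have "G = Q * [:1, 0, 2, 0, 1:] + smult (s + t) (Q * [:0, 1, 0, 1:]) + smult (s * t) (Q * [:0, 0, 1:])"
      unfolding G by (simp only: distrib_right mult_smult_left mult.commute[of Q])
    then have "coeff G i = A + (of_nat b * (s + t) + of_nat g * (s * t))"
      by (simp only: coeff_add coeff_smult A_def b g mult.commute)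
    then show "elem_sym i (2 * n) x = A + (of_nat b * ((u + 1 / u) + (v + 1 / v)) + of_nat g * ((u + 1 / u) * (v + 1 / v)))"
      using coeff_prod_linear_eq_elem_sym[of x "2 * n" i] by (simp add: G_def s_def t_def)
    have "reflect_poly G = G"
      unfolding G Q_def reflect_poly_mult reflect_poly_power by (simp add: reflect_poly_def)
    \<comment> \<open>Reflection reverses coefficients about the actual degree, so the exact degree
      is needed to pair \<open>k\<close> with \<open>2 * n - k\<close>.\<close>
    moreover have "degree G = 2 * n"
    proof -
      have "degree Q = 2 * n - 4"
        unfolding Q_def by (rule degree_linear_power)
      moreover have "Q \<noteq> 0"
        by (simp add: Q_def)
      moreover have "[:1, s, 1:] * [:1, t, 1:] \<noteq> 0" "degree ([:1, s, 1:] * [:1, t, 1:]) = 4"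
        by simp_all
      ultimately show ?thesis
        using \<open>2 \<le> n\<close> unfolding G by (subst degree_mult_eq) (assumption, assumption, linarith)
    qed
    ultimately have sym: "coeff G (2 * n - k) = coeff G k" if "k \<le> 2 * n" for k
      using that coeff_reflect_poly[of G k] by simp
    show "elem_sym (2 * n - i) (2 * n) x = elem_sym i (2 * n) x"
      using sym[of i] assms coeff_prod_linear_eq_elem_sym[of x "2 * n"] by (simp add: G_def)
    have "coeff G 0 = 1"
      unfolding G by (simp add: Q_def coeff_mult_0 coeff_0_power)
    then show "elem_sym (2 * n) (2 * n) x = 1"
      using sym[of "2 * n"] coeff_prod_linear_eq_elem_sym[of x "2 * n"] by (simp add: G_def)
    show "x 1 = u"
      by (simp add: x_def)
  qed
  with \<open>0 \<le> A\<close> bg show ?thesis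
    using that by blast
qed

section \<open>Transfer of the rational solutions to the function field\<close>

theorem theorem2p2:
  fixes i n :: nat
  assumes "1 \<le> i" and "i \<le> n" and "2 \<le> n"
  shows "infinite {a \<in> ratfuns (n - 2) - {0}.
           infinite {x \<in> {1..2 * n} \<rightarrow>\<^sub>E ratfuns (n - 2).
             elem_sym i (2 * n) x = a \<and>
             elem_sym (2 * n - i) (2 * n) x = a \<and>
             elem_sym (2 * n) (2 * n) x = 1}}"
    (is "infinite {a \<in> _. infinite (?Sol a)}")
proof -
  obtain A :: rat and b g :: nat where A: "0 \<le> A" and bg: "b \<noteq> 0 \<or> g \<noteq> 0" and
    sol: "\<And>u v :: rat. u \<noteq> 0 \<Longrightarrow> v \<noteq> 0 \<Longrightarrow> \<exists>x. x 1 = u \<and>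
       elem_sym i (2 * n) x = A + (of_nat b * ((u + 1 / u) + (v + 1 / v)) + of_nat g * ((u + 1 / u) * (v + 1 / v))) \<and>
       elem_sym (2 * n - i) (2 * n) x = elem_sym i (2 * n) x \<and> elem_sym (2 * n) (2 * n) x = 1"
    using elem_sym_reciprocal_pairs[OF assms] by metis
  define U :: "rat \<Rightarrow> rat set" where "U c = {u. u \<noteq> 0 \<and> (\<exists>v. v \<noteq> 0 \<and>
    of_nat b * ((u + 1 / u) + (v + 1 / v)) + of_nat g * ((u + 1 / u) * (v + 1 / v)) = c)}" for c
  define C where "C = {c. 0 < c \<and> infinite (U c)}"
  have "infinite C"
    unfolding C_def U_def using bg by (rule infinite_values_symmetric_curve)
  moreover have "inj (\<lambda>c. const (A + c))"
    by (rule injI) simp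
  ultimately have "infinite ((\<lambda>c. const (A + c)) ` C)"
    by (meson finite_imageD inj_on_subset subset_UNIV)
  moreover have "(\<lambda>c. const (A + c)) ` C \<subseteq> {a \<in> ratfuns (n - 2) - {0}. infinite (?Sol a)}"
  proof (rule image_subsetI)
    fix c assume "c \<in> C"
    then have c: "0 < c" "infinite (U c)"
      by (auto simp: C_def)
    have "\<forall>u\<in>U c. \<exists>x. x 1 = u \<and> elem_sym i (2 * n) x = A + c \<and>
        elem_sym (2 * n - i) (2 * n) x = A + c \<and> elem_sym (2 * n) (2 * n) x = 1"
      unfolding U_def using sol by fastforce
    then obtain x where x: "\<And>u. u \<in> U c \<Longrightarrow> x u 1 = u \<and> elem_sym i (2 * n) (x u) = A + c \<and>
        elem_sym (2 * n - i) (2 * n) (x u) = A + c \<and> elem_sym (2 * n) (2 * n) (x u) = 1"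
      by (rule bchoice[THEN exE]) blast
    define y where "y u = (\<lambda>j\<in>{1..2 * n}. const (x u j))" for u
    \<comment> \<open>The first coordinate of \<open>y u\<close> is \<open>const u\<close>, so
      \<open>u\<close> can be recovered.\<close>
    have "inj_on y (U c)"
    proof (rule inj_onI)
      fix u u' assume u: "u \<in> U c" "u' \<in> U c" "y u = y u'"
      from u(3) have "y u 1 = y u' 1"
        by simp
      with x[OF u(1)] x[OF u(2)] \<open>2 \<le> n\<close> show "u = u'"
        by (simp add: y_def)
    qed
    then have "infinite (y ` U c)"
      using c(2) finite_imageD by blast
    moreover have "y ` U c \<subseteq> ?Sol (const (A + c))"
      using x by (auto simp: y_def elem_sym_const[unfolded One_nat_def] const_ratfuns)
    ultimately have "infinite (?Sol (const (A + c)))"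
      using infinite_super by blast
    \<comment> \<open>Here the signs matter: \<open>0 \<le> A\<close> and \<open>0 < c\<close> keep
      the value away from 0.\<close>
    moreover have "const (A + c) \<noteq> 0"
      using A c(1) const_eq_iff[of "A + c" 0] by (simp del: const_eq_iff)
    ultimately show "const (A + c) \<in> {a \<in> ratfuns (n - 2) - {0}. infinite (?Sol a)}"
      using const_ratfuns by blast
  qed
  ultimately show ?thesis
    using infinite_super by blast
qed

end
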